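(* Let $r\ge 1$ and $m\ge 1$ be integers and let $F$ be a complete $r$-degenerate bipartite graph of complexity $2$ and multiplicity $m$. Then there is a constant $C$ depending only on $F$ such that $\mathrm{ex}(n,F)\le C n^{2-\frac{1}{r}}$ for all $n$.
   Context: For a graph $F$, $\mathrm{ex}(n,F)$ denotes the maximum number of edges in a simple graph on $n$ vertices that does not contain $F$ as a subgraph. Complete $r$-degenerate bipartite graphs of complexity $s$ and multiplicity $m$ are defined recursively: the complete bipartite graph $K_{r,r}$ with parts $A_0,B_0$ is the (unique) such graph of complexity $0$ (for any multiplicity). A bipartite graph with parts $A,B$ is a complete $r$-degenerate bipartite graph of complexity $s$ and multiplicity $m$ if it is obtained from a complete $r$-degenerate bipartite graph with parts $A',B'$ of complexity $s-1$ and multiplicity $m$ by adding $m\left(\binom{|A'|}{r}+\binom{|B'|}{r}\right)$ new vertices, where exactly $m$ new vertices are assigned to each $r$-subset of $A'$ and exactly $m$ to each $r$-subset of $B'$, and each new vertex is joined by edges precisely to the $r$ vertices of the $r$-set it is assigned to (new vertices assigned to $r$-subsets of $A'$ join side $B$, those assigned to $r$-subsets of $B'$ join side $A$). *)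

theory Defs
  imports Complex_Main "HOL-Library.Ramsey"
begin

text \<open>A graph is a pair of a vertex set and a set of edges, each edge being a two-element set of
  vertices. \<open>nsets X k\<close>, also written \<open>[X]\<^bsup>k\<^esup>\<close>, is the set of all \<open>k\<close>-element subsets of \<open>X\<close>.\<close>

type_synonym 'a graph = "'a set \<times> 'a set set"

definition simple_graph :: "'a graph \<Rightarrow> bool" where
  "simple_graph G \<longleftrightarrow> finite (fst G) \<and> snd G \<subseteq> nsets (fst G) 2"

text \<open>The subgraph need not be induced.\<close>

definition contains_subgraph :: "'b graph \<Rightarrow> 'a graph \<Rightarrow> bool" where
  "contains_subgraph G F \<longleftrightarrow>
     (\<exists>f. inj_on f (fst F) \<and> f ` fst F \<subseteq> fst G \<and> (\<forall>e\<in>snd F. f ` e \<in> snd G))"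

text \<open>Host graphs have vertices in \<^typ>\<open>nat\<close>, which is no restriction up to isomorphism.
  The maximum is over a nonempty finite set as soon as \<open>F\<close> is a graph with at least one edge
  (lemmas below); otherwise the set may be empty and its maximum is unspecified.\<close>

definition ex_num :: "nat \<Rightarrow> 'a graph \<Rightarrow> nat" where
  "ex_num n F = Max {card (snd G) | G :: nat graph.
     simple_graph G \<and> card (fst G) = n \<and> \<not> contains_subgraph G F}"

lemma finite_ex_num_set:
  "finite {card (snd G) | G :: nat graph.
     simple_graph G \<and> card (fst G) = n \<and> \<not> contains_subgraph G F}"
proof (rule finite_subset)
  show "{card (snd G) | G :: nat graph.
     simple_graph G \<and> card (fst G) = n \<and> \<not> contains_subgraph G F} \<subseteq> {..n choose 2}"
    by (auto simp: simple_graph_def simp flip: card_nsets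
        intro!: card_mono finite_imp_finite_nsets)
qed simp

lemma ex_num_set_nonempty:
  assumes "snd F \<noteq> {}"
  shows "{card (snd G) | G :: nat graph.
     simple_graph G \<and> card (fst G) = n \<and> \<not> contains_subgraph G F} \<noteq> {}"
proof -
  have "simple_graph ({..<n}, {}) \<and> card (fst ({..<n}, {} :: nat set set)) = n
      \<and> \<not> contains_subgraph ({..<n}, {}) F"
    using assms by (auto simp: simple_graph_def contains_subgraph_def)
  then show ?thesis by blast
qed

text \<open>\<open>complete_degenerate_bipartite r m s A B E\<close>: the bipartite graph with parts \<open>A\<close>, \<open>B\<close> and edge
  set \<open>E\<close> is a complete \<open>r\<close>-degenerate bipartite graph of complexity \<open>s\<close> and multiplicity \<open>m\<close>.
  In the step, \<open>X\<close> and \<open>Y\<close> are the new vertices; \<open>g\<close> and \<open>h\<close> map each of them to the \<open>r\<close>-set it is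
  assigned to, so that every \<open>r\<close>-set has exactly \<open>m\<close> preimages.\<close>

inductive complete_degenerate_bipartite ::
  "nat \<Rightarrow> nat \<Rightarrow> nat \<Rightarrow> 'a set \<Rightarrow> 'a set \<Rightarrow> 'a set set \<Rightarrow> bool" for r m where
  base: "complete_degenerate_bipartite r m 0 A B {{a, b} | a b. a \<in> A \<and> b \<in> B}"
    if "finite A" "finite B" "A \<inter> B = {}" "card A = r" "card B = r"
| step: "complete_degenerate_bipartite r m (Suc s) (A \<union> Y) (B \<union> X)
     (E \<union> {{x, a} | x a. x \<in> X \<and> a \<in> g x} \<union> {{y, b} | y b. y \<in> Y \<and> b \<in> h y})"
    if "complete_degenerate_bipartite r m s A B E"
       "finite X" "finite Y" "X \<inter> (A \<union> B) = {}" "Y \<inter> (A \<union> B) = {}" "X \<inter> Y = {}"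
       "g ` X \<subseteq> nsets A r" "\<forall>S \<in> nsets A r. card {x \<in> X. g x = S} = m"
       "h ` Y \<subseteq> nsets B r" "\<forall>S \<in> nsets B r. card {y \<in> Y. h y = S} = m"

end

theory Submission
  imports Defs
begin

text \<open>Call an \<open>r\<close>-set of vertices rich if it has at least \<open>M\<close> common neighbours, where \<open>M\<close> is the
  number of vertices of \<open>F\<close>. By convexity, a graph with many edges contains at least \<open>L n\<^sup>r\<close> pairs
  \<open>(S, T)\<close> of \<open>r\<close>-sets spanning a copy of \<open>K\<^bsub>r,r\<^esub>\<close>, with \<open>L\<close> as large as we like. Only \<open>O(n\<^sup>r)\<close>
  of these have a poor \<open>T\<close>, since a poor \<open>r\<close>-set has boundedly many \<open>r\<close>-sets of common neighbours.
  Averaging over the \<open>k\<close>-sets between \<open>T\<close> and \<open>N(S)\<close>, only \<open>O(n\<^sup>r)\<close> pairs are such that \<open>T\<close> does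
  not extend to a \<open>k\<close>-set inside \<open>N(S)\<close> all of whose \<open>r\<close>-subsets are rich. Hence some pair
  \<open>(S, T)\<close> extends on both sides. The extensions accommodate the complexity one part of \<open>F\<close>
  (\<open>k = r + 2 m\<close> leaves room to avoid the overlap of the two extensions, as the host graph need
  not be bipartite), and the vertices of the last step are embedded greedily.\<close>

section \<open>Common neighbourhoods\<close>

definition common_nbrs :: "'a graph \<Rightarrow> 'a set \<Rightarrow> 'a set" where
  "common_nbrs G S = {v \<in> fst G. \<forall>s\<in>S. {s, v} \<in> snd G}"

lemma common_nbrs_subset: "common_nbrs G S \<subseteq> fst G"
  by (auto simp: common_nbrs_def)

lemma finite_common_nbrs: "simple_graph G \<Longrightarrow> finite (common_nbrs G S)"
  by (auto simp: common_nbrs_def simple_graph_def)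

lemma common_nbrs_disjoint: "simple_graph G \<Longrightarrow> S \<inter> common_nbrs G S = {}"
  by (auto simp: common_nbrs_def simple_graph_def nsets_def)

lemma common_nbrs_sym:
  assumes "S \<subseteq> fst G" "T \<subseteq> fst G"
  shows "T \<subseteq> common_nbrs G S \<longleftrightarrow> S \<subseteq> common_nbrs G T"
proof -
  have "T \<subseteq> common_nbrs G S \<longleftrightarrow> (\<forall>s\<in>S. \<forall>t\<in>T. {s, t} \<in> snd G)"
    using assms by (auto simp: common_nbrs_def)
  also have "\<dots> \<longleftrightarrow> (\<forall>s\<in>S. \<forall>t\<in>T. {t, s} \<in> snd G)"
    by (intro ball_cong refl) (simp add: insert_commute)
  also have "\<dots> \<longleftrightarrow> S \<subseteq> common_nbrs G T"
    using assms by (auto simp: common_nbrs_def)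
  finally show ?thesis .
qed

text \<open>Copies of the complete bipartite graph with sides of sizes \<open>p\<close> and
  \<open>q\<close>, as ordered pairs: for \<open>p = q\<close> each copy occurs twice, so that
  exchanging the two sides is a bijection of the set.\<close>

definition biclique_pairs :: "'a graph \<Rightarrow> nat \<Rightarrow> nat \<Rightarrow> ('a set \<times> 'a set) set" where
  "biclique_pairs G p q = (SIGMA S:nsets (fst G) p. nsets (common_nbrs G S) q)"

lemma mem_biclique_pairs:
  "(S, T) \<in> biclique_pairs G p q \<longleftrightarrow>
    S \<in> nsets (fst G) p \<and> T \<in> nsets (fst G) q \<and> T \<subseteq> common_nbrs G S"
  using common_nbrs_subset[of G S] by (auto simp: biclique_pairs_def nsets_def)

lemma biclique_pairs_sym: "(S, T) \<in> biclique_pairs G p q \<longleftrightarrow> (T, S) \<in> biclique_pairs G q p"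
  using common_nbrs_sym[of S G T] by (auto simp: mem_biclique_pairs nsets_def)

lemma swap_biclique_pairs: "prod.swap ` biclique_pairs G p q = biclique_pairs G q p"
proof -
  have "prod.swap ` biclique_pairs G p q \<subseteq> biclique_pairs G q p" for p q
    using biclique_pairs_sym by fastforce
  from this[of p q] image_mono[OF this[of q p], of prod.swap] show ?thesis
    by (simp add: image_image)
qed

lemma finite_biclique_pairs: "simple_graph G \<Longrightarrow> finite (biclique_pairs G p q)"
  by (auto simp: biclique_pairs_def simple_graph_def intro!: finite_SigmaI finite_imp_finite_nsets
      finite_common_nbrs)

lemma card_biclique_pairs:
  assumes "simple_graph G"
  shows "card (biclique_pairs G p q)
    = (\<Sum>S\<in>nsets (fst G) p. card (common_nbrs G S) choose q)"
  using assms unfolding biclique_pairs_def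
  by (subst card_SigmaI) (auto simp: simple_graph_def card_nsets intro!: finite_imp_finite_nsets finite_common_nbrs)

lemma card_biclique_pairs_sym: "card (biclique_pairs G p q) = card (biclique_pairs G q p)"
  by (metis swap_biclique_pairs card_image inj_swap)

section \<open>The number of bicliques\<close>

lemma card_edges_le_biclique_pairs:
  assumes "simple_graph G"
  shows "card (snd G) \<le> card (biclique_pairs G 1 1)"
proof (rule surj_card_le[OF finite_biclique_pairs[OF assms]])
  show "snd G \<subseteq> (\<lambda>(S, T). S \<union> T) ` biclique_pairs G 1 1"
  proof
    fix e assume e: "e \<in> snd G"
    then have "e \<in> nsets (fst G) 2" using assms by (auto simp: simple_graph_def)
    then obtain u v where uv: "e = {u, v}" "u \<in> fst G" "v \<in> fst G"
      by (auto simp: nsets_def card_2_iff)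
    then have "({u}, {v}) \<in> biclique_pairs G 1 1"
      using e by (auto simp: biclique_pairs_def nsets_def common_nbrs_def)
    then show "e \<in> (\<lambda>(S, T). S \<union> T) ` biclique_pairs G 1 1"
      using uv by (force intro!: image_eqI[of _ _ "({u}, {v})"])
  qed
qed

text \<open>Jensen's inequality for the \<open>r\<close>-th power. By Bernoulli, the graph of the
  power lies above its tangent at \<open>q\<close>; as the mean of \<open>f\<close> is at least
  \<open>q\<close>, the linear terms sum to something nonnegative.\<close>

lemma sum_power_ge:
  fixes f :: "'b \<Rightarrow> real"
  assumes "finite I" "\<And>i. i \<in> I \<Longrightarrow> f i \<ge> 0" "q > 0" "real (card I) * q \<le> sum f I"
  shows "real (card I) * q ^ r \<le> (\<Sum>i\<in>I. f i ^ r)"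
proof -
  have "real (card I) \<le> real (card I) + real r * (sum f I / q - real (card I))"
    using assms(3,4) by (simp add: pos_le_divide_eq)
  also have "\<dots> = (\<Sum>i\<in>I. 1 + real r * (f i / q - 1))"
    by (simp add: sum.distrib sum_subtractf sum_divide_distrib flip: sum_distrib_left)
  also have "\<dots> \<le> (\<Sum>i\<in>I. (1 + (f i / q - 1)) ^ r)"
    using assms by (intro sum_mono Bernoulli_inequality) auto
  also have "\<dots> = (\<Sum>i\<in>I. f i ^ r) / q ^ r"
    by (simp add: power_divide sum_divide_distrib)
  finally show ?thesis using assms(3) by (simp add: field_simps)
qed

text \<open>The loss of 1 covers \<open>d < r\<close>, where the binomial vanishes but the quotient
  power is at most 1.\<close>

lemma binomial_ge_power:
  fixes d r :: nat
  assumes "r \<ge> 1"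
  shows "(real d / real r) ^ r - 1 \<le> real (d choose r)"
proof (cases "r \<le> d")
  case True
  then show ?thesis using binomial_ge_n_over_k_pow_k[of r d, where 'a = real] by simp
next
  case False
  then have "(real d / real r) ^ r \<le> 1" by (intro power_le_one) auto
  then show ?thesis by (smt (verit) of_nat_0_le_iff)
qed

lemma binomial_le_power: "(n choose r) \<le> n ^ r" for n r :: nat
  by (cases "r \<le> n") (simp_all add: binomial_le_pow binomial_eq_0)

text \<open>By Pascal's rule the binomial grows by at least 1 with each step of \<open>d\<close>
  from \<open>r - 1\<close> onwards.\<close>

lemma binomial_ge_minus:
  fixes d r :: nat
  assumes "r \<ge> 1"
  shows "real d - real r \<le> real (d choose r)"
proof -
  have "d \<le> (d choose r) + r"
    using assms
  proof (induction d)
    case (Suc d)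
    obtain j where j: "r = Suc j" using Suc.prems by (cases r) auto
    show ?case
    proof (cases "j \<le> d")
      case True
      then have "1 \<le> d choose j" by (simp add: Suc_le_eq)
      then show ?thesis using Suc unfolding j binomial_Suc_Suc by linarith
    qed (simp add: j)
  qed simp
  then show ?thesis by linarith
qed

text \<open>Two rounds of counting. Convexity over vertex degrees gives many stars with
  \<open>r\<close> leaves; counted from their leaves, these give a constant average number of common
  neighbours per \<open>r\<close>-set, for which the linear bound \<open>binomial_ge_minus\<close>
  suffices.\<close>

lemma many_bicliques:
  fixes G :: "'a graph" and L :: real
  assumes G: "simple_graph G" and n: "card (fst G) = n" "n \<ge> 1" and r: "r \<ge> 1" and L: "L \<ge> 0"
    and e: "real r ^ r * (L + real r + 1) * real n powr (2 - 1 / real r) \<le> real (card (snd G))"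
  shows "L * real n ^ r \<le> real (card (biclique_pairs G r r))"
proof -
  define C where "C = real r ^ r * (L + real r + 1)"
  \<comment> \<open>A lower bound for the average degree, chosen so that \<open>n * q ^ r\<close> is
    \<open>C ^ r * n ^ r\<close>.\<close>
  define q where "q = C * real n powr (1 - 1 / real r)"
  let ?d = "\<lambda>S. card (common_nbrs G S)"
  have fin: "finite (fst G)" using G by (simp add: simple_graph_def)
  have "real r ^ r \<ge> 1" using r by simp
  then have C1: "C \<ge> 1" unfolding C_def
    using L mult_mono[of 1 "real r ^ r" 1 "L + real r + 1"] by simp
  have q0: "q > 0" using C1 n by (simp add: q_def)
  have "real n * q = C * real n powr (2 - 1 / real r)"
  proof -
    have "real n * real n powr (1 - 1 / real r) = real n powr (1 + (1 - 1 / real r))"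
      using n by (subst powr_add) simp
    then show ?thesis by (simp add: q_def)
  qed
  also have "\<dots> \<le> real (card (biclique_pairs G 1 1))"
    using e card_edges_le_biclique_pairs[OF G] by (simp add: C_def)
  also have "\<dots> = (\<Sum>S\<in>nsets (fst G) 1. real (?d S))"
    by (simp add: card_biclique_pairs[OF G])
  finally have sum_deg: "real (card (nsets (fst G) 1)) * q \<le> (\<Sum>S\<in>nsets (fst G) 1. real (?d S))"
    by (simp add: card_nsets n)
  have "(real n powr (1 - 1 / real r)) ^ r = real n powr (real r - 1)"
  proof -
    have "(1 - 1 / real r) * real r = real r - 1" using r by (simp add: field_simps)
    then show ?thesis using n by (simp add: powr_powr flip: powr_realpow)
  qed
  also have "\<dots> = real n ^ (r - 1)"
    using r n by (simp add: of_nat_diff flip: powr_realpow)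
  finally have qr: "real n * q ^ r = C ^ r * real n ^ r"
    using r by (simp add: q_def power_mult_distrib flip: power_Suc)
  \<comment> \<open>As \<open>C\<close> is at least 1, one factor \<open>C\<close> is kept; its
    \<open>r ^ r\<close> cancels the denominator of \<open>binomial_ge_power\<close>.\<close>
  have "C * real n ^ r \<le> C ^ r * real n ^ r"
    using C1 r by (intro mult_right_mono self_le_power) auto
  also have "\<dots> \<le> (\<Sum>S\<in>nsets (fst G) 1. real (?d S) ^ r)"
    using sum_power_ge[OF _ _ q0 sum_deg, of r] fin qr by (simp add: card_nsets n finite_imp_finite_nsets)
  finally have "(L + real r + 1) * real n ^ r - real n
      \<le> (\<Sum>S\<in>nsets (fst G) 1. real (?d S) ^ r) / real r ^ r - real n"
    using r by (simp add: C_def field_simps)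
  also have "\<dots> = (\<Sum>S\<in>nsets (fst G) 1. (real (?d S) / real r) ^ r - 1)"
    by (simp add: sum_subtractf power_divide sum_divide_distrib card_nsets n)
  also have "\<dots> \<le> (\<Sum>S\<in>nsets (fst G) 1. real (?d S choose r))"
    by (intro sum_mono binomial_ge_power r)
  \<comment> \<open>Double counting of stars: from sums over centres to sums over
    \<open>r\<close>-sets of leaves.\<close>
  also have "\<dots> = real (card (biclique_pairs G r 1))"
    by (subst card_biclique_pairs_sym) (simp add: card_biclique_pairs[OF G])
  also have "\<dots> = (\<Sum>S\<in>nsets (fst G) r. real (?d S))"
    by (simp add: card_biclique_pairs[OF G])
  finally have 1: "(L + real r + 1) * real n ^ r - real n \<le> (\<Sum>S\<in>nsets (fst G) r. real (?d S))" .
  have "real (n choose r) \<le> real n ^ r"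
    using binomial_le_power[of n r] by (metis of_nat_le_iff of_nat_power)
  moreover have "real n \<le> real n ^ r" using n r by (intro self_le_power) auto
  \<comment> \<open>Of the factor \<open>L + r + 1\<close>, the 1 pays for the loss of 1 per vertex
    in the first round and the \<open>r\<close> for the loss of \<open>r\<close> per
    \<open>r\<close>-set in the second.\<close>
  ultimately have "L * real n ^ r \<le> (L + real r + 1) * real n ^ r - real n - real r * real (n choose r)"
    using mult_left_mono[of "real (n choose r)" "real n ^ r" "real r"]
    unfolding distrib_right mult_1_left by linarith
  also have "\<dots> \<le> (\<Sum>S\<in>nsets (fst G) r. real (?d S)) - real r * real (n choose r)"
    using 1 by linarith
  also have "\<dots> = (\<Sum>S\<in>nsets (fst G) r. real (?d S) - real r)"
    by (simp add: sum_subtractf card_nsets n)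
  also have "\<dots> \<le> (\<Sum>S\<in>nsets (fst G) r. real (?d S choose r))"
    by (intro sum_mono binomial_ge_minus r)
  also have "\<dots> = real (card (biclique_pairs G r r))"
    by (simp add: card_biclique_pairs[OF G])
  finally show ?thesis .
qed

section \<open>Extending one side of a biclique\<close>

lemma card_nsets_supersets:
  assumes "finite N" "S \<in> nsets N r" "r \<le> k"
  shows "card {T \<in> nsets N k. S \<subseteq> T} = (card N - r) choose (k - r)"
proof -
  have S: "S \<subseteq> N" "finite S" "card S = r" using assms by (auto simp: nsets_def)
  have "bij_betw (\<lambda>T. T - S) {T \<in> nsets N k. S \<subseteq> T} (nsets (N - S) (k - r))"
    by (rule bij_betw_byWitness[where f' = "\<lambda>T. T \<union> S"])
       (use S assms(3) in \<open>auto simp: nsets_def card_Diff_subset card_Un_disjoint Diff_disjoint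
          intro!: card_Un_disjoint[THEN trans]\<close>)
  then have "card {T \<in> nsets N k. S \<subseteq> T} = card (nsets (N - S) (k - r))"
    by (rule bij_betw_same_card)
  then show ?thesis using S by (simp add: card_nsets card_Diff_subset)
qed

text \<open>Count pairs of a non-extendable \<open>S\<close> and a \<open>k\<close>-set
  \<open>T\<close> containing it. Each \<open>S\<close> lies in \<open>c\<close> such
  \<open>T\<close>, and each \<open>T\<close> contains a bad set. At most
  \<open>c * card Bad\<close> sets \<open>T\<close> do so, each with \<open>k choose r\<close>
  subsets \<open>S\<close>; then \<open>c\<close> cancels.\<close>

lemma card_non_extendable_le:
  assumes N: "finite N" "k \<le> card N" and "r \<le> k" and Bad: "Bad \<subseteq> nsets N r"
  shows "card {S \<in> nsets N r. \<not> (\<exists>T\<in>nsets N k. S \<subseteq> T \<and> nsets T r \<inter> Bad = {})}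
    \<le> (k choose r) * card Bad" (is "card ?NE \<le> _")
proof -
  define c where "c = (card N - r) choose (k - r)"
  \<comment> \<open>The final cancellation rests on this, hence the hypothesis that \<open>N\<close>
    has at least \<open>k\<close> elements.\<close>
  have c0: "c > 0" using N \<open>r \<le> k\<close> by (simp add: c_def)
  have finNE: "finite ?NE" using N by (simp add: finite_imp_finite_nsets)
  have finBad: "finite Bad" using Bad N by (meson finite_imp_finite_nsets finite_subset)
  let ?ext = "\<lambda>S. {T \<in> nsets N k. S \<subseteq> T}"
  have finext: "finite (?ext S)" for S using N by (simp add: finite_imp_finite_nsets)
  let ?P = "SIGMA S:?NE. ?ext S"
  let ?Q = "SIGMA T:(\<Union>D\<in>Bad. ?ext D). nsets T r"
  have "card ?NE * c = card ?P"
  proof -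
    have "card ?P = (\<Sum>S\<in>?NE. card (?ext S))" using finNE finext by (intro card_SigmaI) auto
    also have "\<dots> = (\<Sum>S\<in>?NE. c)"
      using N(1) \<open>r \<le> k\<close> unfolding c_def by (intro sum.cong card_nsets_supersets) auto
    finally show ?thesis by simp
  qed
  also have "\<dots> = card (prod.swap ` ?P)" by (simp add: card_image)
  also have "\<dots> \<le> card ?Q"
  proof (rule card_mono)
    show "finite ?Q" using finBad finext
      by (intro finite_SigmaI finite_UN_I finite_imp_finite_nsets) (auto simp: nsets_def)
    show "prod.swap ` ?P \<subseteq> ?Q"
    proof clarsimp
      fix S T
      assume S: "S \<in> nsets N r" "\<forall>T\<in>nsets N k. S \<subseteq> T \<longrightarrow> nsets T r \<inter> Bad \<noteq> {}"
        and T: "T \<in> nsets N k" "S \<subseteq> T"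
      then obtain D where "D \<in> nsets T r" "D \<in> Bad" by blast
      then show "(\<exists>D\<in>Bad. D \<subseteq> T) \<and> S \<in> nsets T r" using S T by (auto simp: nsets_def)
    qed
  qed
  also have "\<dots> = (\<Sum>T\<in>(\<Union>D\<in>Bad. ?ext D). k choose r)"
    using finBad finext
    by (subst card_SigmaI) (auto simp: card_nsets nsets_def[of N k] intro!: sum.cong finite_imp_finite_nsets)
  also have "\<dots> = (k choose r) * card (\<Union>D\<in>Bad. ?ext D)" by simp
  also have "\<dots> \<le> (k choose r) * (\<Sum>D\<in>Bad. card (?ext D))"
    by (intro mult_left_mono card_UN_le finBad) simp
  also have "\<dots> = (k choose r) * (card Bad * c)"
  proof -
    have "(\<Sum>D\<in>Bad. card (?ext D)) = (\<Sum>D\<in>Bad. c)"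
      using Bad N(1) \<open>r \<le> k\<close> unfolding c_def by (intro sum.cong card_nsets_supersets) auto
    then show ?thesis by simp
  qed
  finally show ?thesis using c0 by simp
qed

section \<open>Rich sets and the count of non-extendable pairs\<close>

definition rich :: "'a graph \<Rightarrow> nat \<Rightarrow> nat \<Rightarrow> 'a set \<Rightarrow> bool" where
  "rich G r M T \<longleftrightarrow> (\<forall>D\<in>nsets T r. M \<le> card (common_nbrs G D))"

text \<open>It is \<open>T\<close> that grows, while all of the larger set stays joined to
  \<open>S\<close>. Growth of \<open>S\<close> is the same predicate with the arguments
  exchanged.\<close>

definition extendable :: "'a graph \<Rightarrow> nat \<Rightarrow> nat \<Rightarrow> nat \<Rightarrow> 'a set \<Rightarrow> 'a set \<Rightarrow> bool" where
  "extendable G r M k S T \<longleftrightarrow> (\<exists>T'\<in>nsets (common_nbrs G S) k. T \<subseteq> T' \<and> rich G r M T')"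

text \<open>Counted from the side of \<open>T\<close>: a poor \<open>T\<close> has fewer than
  \<open>M\<close> common neighbours, among which \<open>S\<close> must be chosen.\<close>

lemma card_poor_pairs_le:
  assumes G: "simple_graph G"
  shows "card {(S, T) \<in> biclique_pairs G r r. card (common_nbrs G T) < M}
    \<le> (M choose r) * (card (fst G) choose r)" (is "card ?P \<le> _")
proof -
  have fin: "finite (fst G)" using G by (simp add: simple_graph_def)
  define Poor where "Poor = {T \<in> nsets (fst G) r. card (common_nbrs G T) < M}"
  have finPoor: "finite Poor" using fin by (simp add: Poor_def finite_imp_finite_nsets)
  have sub: "prod.swap ` ?P \<subseteq> (SIGMA T:Poor. nsets (common_nbrs G T) r)"
  proof
    fix x assume x: "x \<in> prod.swap ` ?P"
    then have "x \<in> biclique_pairs G r r"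
      using swap_biclique_pairs[of G r r] by blast
    then show "x \<in> (SIGMA T:Poor. nsets (common_nbrs G T) r)"
      using x by (auto simp: biclique_pairs_def Poor_def)
  qed
  have "card ?P = card (prod.swap ` ?P)" by (simp add: card_image)
  also have "\<dots> \<le> card (SIGMA T:Poor. nsets (common_nbrs G T) r)"
    using finPoor by (intro card_mono sub finite_SigmaI finite_imp_finite_nsets finite_common_nbrs G)
  also have "\<dots> = (\<Sum>T\<in>Poor. card (common_nbrs G T) choose r)"
    using finPoor by (subst card_SigmaI) (auto simp: card_nsets intro!: finite_imp_finite_nsets finite_common_nbrs G)
  also have "\<dots> \<le> (\<Sum>T\<in>Poor. M choose r)"
    by (intro sum_mono binomial_right_mono) (auto simp: Poor_def)
  also have "\<dots> \<le> (M choose r) * (card (fst G) choose r)"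
  proof -
    have "card Poor \<le> card (nsets (fst G) r)"
      using fin by (intro card_mono) (auto simp: Poor_def finite_imp_finite_nsets)
    then show ?thesis by (simp add: card_nsets)
  qed
  finally show ?thesis .
qed

text \<open>For fixed \<open>S\<close>, apply \<open>card_non_extendable_le\<close> inside the
  common neighbourhood of \<open>S\<close>, the bad sets being its poor \<open>r\<close>-subsets.
  Summed over \<open>S\<close>, the bad sets are the poor pairs.\<close>

lemma card_non_extendable_pairs_le:
  assumes G: "simple_graph G" and "r \<le> k"
  shows "card {(S, T) \<in> biclique_pairs G r r. \<not> extendable G r M k S T}
    \<le> (k choose r) * ((M choose r) + 1) * (card (fst G) choose r)" (is "card ?P \<le> _")
proof -
  let ?N = "common_nbrs G"
  define Bad where "Bad S = {T \<in> nsets (?N S) r. card (?N T) < M}" for S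
  have fin: "finite (fst G)" using G by (simp add: simple_graph_def)
  have finBad: "finite (Bad S)" for S by (simp add: Bad_def finite_imp_finite_nsets finite_common_nbrs G)
  have poor: "{(S, T) \<in> biclique_pairs G r r. card (?N T) < M} = (SIGMA S:nsets (fst G) r. Bad S)"
    by (auto simp: biclique_pairs_def Bad_def)
  have one: "card {T \<in> nsets (?N S) r. \<not> extendable G r M k S T} \<le> (k choose r) * (card (Bad S) + 1)"
    (is "card ?T \<le> _") for S
  proof (cases "k \<le> card (?N S)")
    case True
    have "rich G r M T \<longleftrightarrow> nsets T r \<inter> Bad S = {}" if "T \<in> nsets (?N S) k" for T
    proof -
      have "nsets T r \<subseteq> nsets (?N S) r" using that by (intro nsets_mono) (simp add: nsets_def)
      then show ?thesis by (auto simp: rich_def Bad_def not_less[symmetric])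
    qed
    then have "extendable G r M k S T
        \<longleftrightarrow> (\<exists>T'\<in>nsets (?N S) k. T \<subseteq> T' \<and> nsets T' r \<inter> Bad S = {})" for T
      unfolding extendable_def by blast
    then have "card ?T \<le> (k choose r) * card (Bad S)"
      using card_non_extendable_le[OF finite_common_nbrs[OF G] True \<open>r \<le> k\<close>, of "Bad S"]
      by (simp add: Bad_def)
    then show ?thesis by simp
  next
    \<comment> \<open>No \<open>k\<close>-set fits, so every \<open>T\<close> fails to extend; but
      there are at most \<open>k choose r\<close> of them. This is the source of the
      \<open>+ 1\<close>.\<close>
    case False
    have "card ?T \<le> card (nsets (?N S) r)"
      by (intro card_mono finite_imp_finite_nsets finite_common_nbrs G) auto
    also have "\<dots> \<le> k choose r" using False by (simp add: card_nsets binomial_right_mono)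
    finally show ?thesis by simp
  qed
  have "?P = (SIGMA S:nsets (fst G) r. {T \<in> nsets (?N S) r. \<not> extendable G r M k S T})"
    by (auto simp: biclique_pairs_def)
  then have "card ?P = (\<Sum>S\<in>nsets (fst G) r. card {T \<in> nsets (?N S) r. \<not> extendable G r M k S T})"
    using fin by (simp add: card_SigmaI finite_imp_finite_nsets finite_common_nbrs G)
  also have "\<dots> \<le> (\<Sum>S\<in>nsets (fst G) r. (k choose r) * (card (Bad S) + 1))"
    by (intro sum_mono one)
  also have "\<dots> = (k choose r) * (card (SIGMA S:nsets (fst G) r. Bad S) + (card (fst G) choose r))"
    using fin finBad
    by (simp add: card_SigmaI finite_imp_finite_nsets card_nsets sum.distrib distrib_left sum_distrib_left)
  also have "\<dots> \<le> (k choose r) * ((M choose r) * (card (fst G) choose r) + (card (fst G) choose r))"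
    using card_poor_pairs_le[OF G, of r M] unfolding poor by (intro mult_left_mono add_mono) auto
  finally show ?thesis by (simp add: algebra_simps)
qed

text \<open>The pairs failing on one side are the swaps of those failing on the other. Each kind
  makes up less than half of all pairs, so some pair fails on neither side.\<close>

lemma ex_extendable_pair:
  assumes G: "simple_graph G" and "r \<le> k"
    and many: "2 * (k choose r) * ((M choose r) + 1) * (card (fst G) choose r)
      < card (biclique_pairs G r r)"
  obtains S T where "(S, T) \<in> biclique_pairs G r r"
    "extendable G r M k S T" "extendable G r M k T S"
proof -
  let ?P = "{(S, T) \<in> biclique_pairs G r r. \<not> extendable G r M k S T}"
  have finP: "finite ?P"
    using finite_biclique_pairs[OF G, of r r] by (rule rev_finite_subset) auto
  have "card (?P \<union> prod.swap ` ?P) \<le> card ?P + card (prod.swap ` ?P)" by (rule card_Un_le)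
  also have "\<dots> = 2 * card ?P" by (simp add: card_image)
  also have "\<dots> < card (biclique_pairs G r r)"
    using many card_non_extendable_pairs_le[OF G \<open>r \<le> k\<close>, of M] by linarith
  finally have "\<not> biclique_pairs G r r \<subseteq> ?P \<union> prod.swap ` ?P"
    using card_mono[of "?P \<union> prod.swap ` ?P" "biclique_pairs G r r"] finP
    by (meson finite_UnI finite_imageI not_le)
  then obtain x where x: "x \<in> biclique_pairs G r r" "x \<notin> ?P" "x \<notin> prod.swap ` ?P" by blast
  obtain S T where "x = (S, T)" by fastforce
  with x have ST: "(S, T) \<in> biclique_pairs G r r" "(S, T) \<notin> ?P" "prod.swap (T, S) \<notin> prod.swap ` ?P"
    by simp_all
  from ST(3) have "(T, S) \<notin> ?P" by blast
  moreover have "(T, S) \<in> biclique_pairs G r r"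
    using ST(1) by (simp add: biclique_pairs_sym[of T])
  ultimately show ?thesis using ST by (intro that[of S T]) simp_all
qed

section \<open>The embedding\<close>

lemma inj_on_Un_disjoint:
  "inj_on f A \<Longrightarrow> inj_on f B \<Longrightarrow> f ` A \<inter> f ` B = {} \<Longrightarrow> inj_on f (A \<union> B)"
  by (auto simp: inj_on_Un)

text \<open>\<open>W\<close> holds the forbidden values. Each chosen image joins \<open>W\<close> as
  its argument leaves \<open>Z\<close>, so \<open>card W + card Z\<close> is constant along the
  induction.\<close>

lemma greedy_injection:
  assumes "finite Z" "finite W" "\<And>z. z \<in> Z \<Longrightarrow> card W + card Z \<le> card (P z)"
  shows "\<exists>h. inj_on h Z \<and> (\<forall>z\<in>Z. h z \<in> P z - W)"
  using assms
proof (induction Z arbitrary: W rule: finite_induct)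
  case (insert z Z)
  have "card W < card (P z)" using insert.prems(2)[of z] insert.hyps by simp
  then have "\<not> P z \<subseteq> W" using card_mono[OF insert.prems(1)] by (metis not_le)
  then obtain p where p: "p \<in> P z" "p \<notin> W" by blast
  have "\<exists>h. inj_on h Z \<and> (\<forall>z\<in>Z. h z \<in> P z - insert p W)"
    using insert.prems insert.hyps p by (intro insert.IH) auto
  then obtain h where "inj_on h Z" "\<forall>z\<in>Z. h z \<in> P z - insert p W" by blast
  then show ?case using p insert.hyps
    by (intro exI[of _ "h(z := p)"]) (auto simp: inj_on_def)
qed simp

text \<open>A part with \<open>r\<close> vertices has a single \<open>r\<close>-subset, so each side
  gains just \<open>m\<close> vertices, all joined to the whole opposite base. The graph is the
  complete bipartite graph on \<open>r + m\<close> and \<open>r + m\<close> vertices without the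
  edges between \<open>X\<close> and \<open>Y\<close>.\<close>

lemma complexity_one_cases:
  assumes "complete_degenerate_bipartite r m (Suc 0) A B E"
  obtains A0 B0 X Y where "A = A0 \<union> Y" "B = B0 \<union> X" "finite A" "finite B" "A \<inter> B = {}"
    "A0 \<inter> Y = {}" "B0 \<inter> X = {}" "card A0 = r" "card B0 = r" "card X = m" "card Y = m"
    "\<And>e. e \<in> E \<Longrightarrow> \<exists>a\<in>A. \<exists>b\<in>B. (a \<in> A0 \<or> b \<in> B0) \<and> e = {a, b}"
  using assms
proof (cases rule: complete_degenerate_bipartite.cases)
  case (step A0 B0 E0 X Y g h)
  have cards: "finite A0" "finite B0" "A0 \<inter> B0 = {}" "card A0 = r" "card B0 = r"
    and E0: "E0 = {{a, b} | a b. a \<in> A0 \<and> b \<in> B0}"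
    using step(4) by (auto elim: complete_degenerate_bipartite.cases)
  have nsets_self: "nsets U (card U) = {U}" if "finite U" for U :: "'a set"
    using that finite_subset[OF _ that] by (auto simp: nsets_def dest: card_subset_eq)
  have nA: "nsets A0 r = {A0}" and nB: "nsets B0 r = {B0}"
    using nsets_self[of A0] nsets_self[of B0] cards by simp_all
  have g: "\<forall>x\<in>X. g x = A0" and h: "\<forall>y\<in>Y. h y = B0" using step(10,12) unfolding nA nB by blast+
  then have "{x \<in> X. g x = A0} = X" "{y \<in> Y. h y = B0} = Y" by auto
  then have "card X = m" "card Y = m" using step(11,13) nA nB by auto
  moreover have "\<exists>a\<in>A. \<exists>b\<in>B. (a \<in> A0 \<or> b \<in> B0) \<and> e = {a, b}" if "e \<in> E" for e
  proof -
    from that consider a b where "e = {a, b}" "a \<in> A0" "b \<in> B0"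
      | x a where "e = {x, a}" "x \<in> X" "a \<in> A0" | y b where "e = {y, b}" "y \<in> Y" "b \<in> B0"
      unfolding step(3) E0 using g h by blast
    then show ?thesis
    proof cases
      case (2 x a)
      then have "e = {a, x}" by auto
      then show ?thesis using 2 step(1,2) by blast
    qed (use step(1,2) in blast)+
  qed
  moreover have "finite A" "finite B" "A \<inter> B = {}" "A0 \<inter> Y = {}" "B0 \<inter> X = {}"
    using step(1,2,5-9) cards by auto
  ultimately show ?thesis using cards by (intro that[OF step(1,2)]) auto
qed

text \<open>The bases \<open>A0\<close> and \<open>B0\<close> go to \<open>S0\<close> and
  \<open>T0\<close>, the new vertices to the rest of \<open>S\<close> and \<open>T\<close>. Every
  edge meets a base, and \<open>S0\<close> is joined to all of \<open>T\<close>, \<open>T0\<close>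
  to all of \<open>S\<close>.\<close>

lemma embed_complexity_one:
  assumes G: "simple_graph G" and F: "complete_degenerate_bipartite r m (Suc 0) A B E"
    and S: "finite S" "S0 \<subseteq> S" "S \<subseteq> common_nbrs G T0" "card S0 = r" "r + m \<le> card S"
    and T: "finite T" "T0 \<subseteq> T" "T \<subseteq> common_nbrs G S0" "card T0 = r" "r + 2 * m \<le> card T"
  shows "\<exists>f. inj_on f (A \<union> B) \<and> f ` A \<subseteq> S \<and> f ` B \<subseteq> T \<and> (\<forall>e\<in>E. f ` e \<in> snd G)"
proof -
  obtain A0 B0 X Y where F: "A = A0 \<union> Y" "B = B0 \<union> X" "finite A" "finite B"
    "A \<inter> B = {}" "A0 \<inter> Y = {}" "B0 \<inter> X = {}" "card A0 = r" "card B0 = r"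
    "card X = m" "card Y = m"
    and E: "\<And>e. e \<in> E \<Longrightarrow> \<exists>a\<in>A. \<exists>b\<in>B. (a \<in> A0 \<or> b \<in> B0) \<and> e = {a, b}"
    using F by (rule complexity_one_cases) blast
  have fin: "finite A0" "finite B0" "finite X" "finite Y" using F by auto
  have finST: "finite S0" "finite T0" using S T by (auto intro: finite_subset)
  \<comment> \<open>Without loops, a set is disjoint from its common neighbourhood. Hence
    \<open>S\<close> and \<open>T\<close> can overlap only outside \<open>S0\<close> and
    \<open>T0\<close>.\<close>
  have disj: "S0 \<inter> T = {}" "S \<inter> T0 = {}"
    using common_nbrs_disjoint[OF G] S(3) T(3) by blast+
  obtain fA where fA: "fA ` A0 \<subseteq> S0" "inj_on fA A0"
    using card_le_inj[OF fin(1) finST(1)] F S by auto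
  obtain fB where fB: "fB ` B0 \<subseteq> T0" "inj_on fB B0"
    using card_le_inj[OF fin(2) finST(2)] F T by auto
  have "m \<le> card (S - S0)" using S finST by (simp add: card_Diff_subset)
  then obtain fY where fY: "fY ` Y \<subseteq> S - S0" "inj_on fY Y"
    using card_le_inj[OF fin(4), of "S - S0"] S F by auto
  \<comment> \<open>The image of \<open>Y\<close> may use up to \<open>m\<close> of these vertices,
    which leaves \<open>m\<close> for \<open>X\<close>.\<close>
  have "2 * m \<le> card (T - T0)" using T finST by (simp add: card_Diff_subset)
  moreover have "card (T - T0) - card (fY ` Y) \<le> card (T - T0 - fY ` Y)"
    using fin by (intro diff_card_le_card_Diff) simp
  ultimately have "m \<le> card (T - T0 - fY ` Y)"
    using card_image[OF fY(2)] F by simp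
  then obtain fX where fX: "fX ` X \<subseteq> T - T0 - fY ` Y" "inj_on fX X"
    using card_le_inj[OF fin(3), of "T - T0 - fY ` Y"] T F by auto
  define f where "f v = (if v \<in> A0 then fA v else if v \<in> Y then fY v
      else if v \<in> B0 then fB v else fX v)" for v
  have f: "\<And>v. v \<in> A0 \<Longrightarrow> f v = fA v" "\<And>v. v \<in> Y \<Longrightarrow> f v = fY v"
      "\<And>v. v \<in> B0 \<Longrightarrow> f v = fB v" "\<And>v. v \<in> X \<Longrightarrow> f v = fX v"
    using F(1,2,5-7) by (auto simp: f_def)
  have img: "f ` A0 = fA ` A0" "f ` Y = fY ` Y" "f ` B0 = fB ` B0" "f ` X = fX ` X"
    using f by (auto intro!: image_cong)
  have "inj_on f A0" "inj_on f Y" "inj_on f B0" "inj_on f X"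
    using fA(2) fB(2) fX(2) fY(2) inj_on_cong[of A0 f fA] inj_on_cong[of Y f fY]
      inj_on_cong[of B0 f fB] inj_on_cong[of X f fX] f by simp_all
  moreover have "fA ` A0 \<inter> fY ` Y = {}" using fA(1) fY(1) by blast
  moreover have "fB ` B0 \<inter> fX ` X = {}" using fB(1) fX(1) by blast
  moreover have "f ` (A0 \<union> Y) \<inter> f ` (B0 \<union> X) = {}"
  proof -
    have "fA ` A0 \<inter> fB ` B0 = {}" using fA(1) fB(1) T(2) disj(1) by blast
    moreover have "fA ` A0 \<inter> fX ` X = {}" using fA(1) fX(1) disj(1) by blast
    moreover have "fY ` Y \<inter> fB ` B0 = {}" using fY(1) fB(1) disj(2) by blast
    moreover have "fY ` Y \<inter> fX ` X = {}" using fX(1) by blast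
    ultimately show ?thesis by (simp add: image_Un img Int_Un_distrib Int_Un_distrib2)
  qed
  ultimately have "inj_on f (A \<union> B)"
    unfolding F(1,2) by (intro inj_on_Un_disjoint) (simp_all only: img)
  moreover have imgA: "f ` A \<subseteq> S"
    unfolding F(1) image_Un img using fA(1) fY(1) S(2) by blast
  moreover have imgB: "f ` B \<subseteq> T"
    unfolding F(2) image_Un img using fB(1) fX(1) T(2) by blast
  moreover have "f ` e \<in> snd G" if e: "e \<in> E" for e
  proof -
    obtain a b where ab: "a \<in> A" "b \<in> B" "a \<in> A0 \<or> b \<in> B0" "e = {a, b}"
      using E[OF e] by blast
    from ab(3) have "{f a, f b} \<in> snd G"
    proof
      assume "a \<in> A0"
      then have "f a \<in> S0" using f(1)[of a] fA(1) by auto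
      moreover have "f b \<in> common_nbrs G S0" using imgB T(3) ab(2) by blast
      ultimately show ?thesis by (auto simp: common_nbrs_def)
    next
      assume "b \<in> B0"
      then have "f b \<in> T0" using f(3)[of b] fB(1) by auto
      moreover have "f a \<in> common_nbrs G T0" using imgA S(3) ab(1) by blast
      ultimately show ?thesis by (auto simp: common_nbrs_def insert_commute)
    qed
    then show ?thesis using ab(4) by simp
  qed
  ultimately show ?thesis by blast
qed

text \<open>The complexity one part goes into the two rich extensions. Each \<open>r\<close>-set to
  which a new vertex is assigned then has a rich image, with at least as many common neighbours as
  \<open>F\<close> has vertices, so a free one is always left.\<close>

lemma embed_complexity_two:
  assumes G: "simple_graph G"
    and F: "complete_degenerate_bipartite r m (Suc (Suc 0)) A B E"
    and k: "k = r + 2 * m" and M: "M = card (A \<union> B)"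
    and pair: "(S0, T0) \<in> biclique_pairs G r r"
    and ext: "extendable G r M k S0 T0" "extendable G r M k T0 S0"
  shows "contains_subgraph G (A \<union> B, E)"
  using F
proof (cases rule: complete_degenerate_bipartite.cases)
  case (step A1 B1 E1 X Y g h)
  let ?N = "common_nbrs G"
  obtain T where T: "T \<subseteq> ?N S0" "finite T" "card T = k" "T0 \<subseteq> T" "rich G r M T"
    using ext(1) by (auto simp: extendable_def nsets_def)
  obtain S where S: "S \<subseteq> ?N T0" "finite S" "card S = k" "S0 \<subseteq> S" "rich G r M S"
    using ext(2) by (auto simp: extendable_def nsets_def)
  have "card S0 = r" "card T0 = r"
    using pair by (auto simp: biclique_pairs_def nsets_def)
  then obtain f1 where inj1: "inj_on f1 (A1 \<union> B1)" and imgA: "f1 ` A1 \<subseteq> S" and imgB: "f1 ` B1 \<subseteq> T"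
    and E1_edge: "\<And>e. e \<in> E1 \<Longrightarrow> f1 ` e \<in> snd G"
    using embed_complexity_one[OF G step(4) S(2,4,1) _ _ T(2,4,1)] S(3) T(3) k by auto
  have E1: "e \<subseteq> A1 \<union> B1" if "e \<in> E1" for e
    using step(4) by (rule complexity_one_cases) (use that in blast)
  have fin1: "finite (A1 \<union> B1)" using step(4) by (rule complexity_one_cases) simp
  have AB: "A \<union> B = (A1 \<union> B1) \<union> (X \<union> Y)" using step(1,2) by auto
  have new: "(A1 \<union> B1) \<inter> (X \<union> Y) = {}" using step(7,8) by auto
  \<comment> \<open>The admissible images of a new vertex \<open>z\<close>; \<open>X\<close> and
    \<open>Y\<close> are disjoint, so the case distinction picks the right assignment.\<close>
  define P where "P z = ?N (f1 ` (if z \<in> X then g z else h z))" for z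
  have rich_img: "M \<le> card (?N (f1 ` D))"
    if "D \<in> nsets U r" "inj_on f1 U" "f1 ` U \<subseteq> R" "rich G r M R" for D U R
  proof -
    have "f1 ` D \<in> nsets R r"
      using that by (auto simp: nsets_def card_image inj_on_subset)
    then show ?thesis using that(4) by (simp add: rich_def)
  qed
  have rich_P: "M \<le> card (P z)" if "z \<in> X \<union> Y" for z
  proof (cases "z \<in> X")
    case True
    then have "g z \<in> nsets A1 r" using step(10) by auto
    moreover have "inj_on f1 A1" using inj1 by (simp add: inj_on_Un)
    ultimately show ?thesis using rich_img imgA S(5) True by (auto simp: P_def)
  next
    case False
    then have "h z \<in> nsets B1 r" using step(12) that by auto
    moreover have "inj_on f1 B1" using inj1 by (simp add: inj_on_Un)
    ultimately show ?thesis using rich_img imgB T(5) False by (auto simp: P_def)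
  qed
  \<comment> \<open>This is the budget of \<open>greedy_injection\<close>, the forbidden set being
    the image of the old vertices.\<close>
  have "M = card (A1 \<union> B1) + card (X \<union> Y)"
    unfolding M AB using fin1 step(5,6) new by (intro card_Un_disjoint) auto
  then have "M = card (f1 ` (A1 \<union> B1)) + card (X \<union> Y)" using inj1 by (simp add: card_image)
  then have "\<exists>\<phi>. inj_on \<phi> (X \<union> Y) \<and> (\<forall>z\<in>X \<union> Y. \<phi> z \<in> P z - f1 ` (A1 \<union> B1))"
    using rich_P step(5,6) fin1 by (intro greedy_injection) auto
  then obtain \<phi> where \<phi>: "inj_on \<phi> (X \<union> Y)" "\<And>z. z \<in> X \<union> Y \<Longrightarrow> \<phi> z \<in> P z"
      "\<And>z. z \<in> X \<union> Y \<Longrightarrow> \<phi> z \<notin> f1 ` (A1 \<union> B1)" by blast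
  define f where "f v = (if v \<in> A1 \<union> B1 then f1 v else \<phi> v)" for v
  have f_old: "\<And>v. v \<in> A1 \<union> B1 \<Longrightarrow> f v = f1 v" and f_new: "\<And>v. v \<in> X \<union> Y \<Longrightarrow> f v = \<phi> v"
    using new by (auto simp: f_def)
  have img: "f ` (A1 \<union> B1) = f1 ` (A1 \<union> B1)" "f ` (X \<union> Y) = \<phi> ` (X \<union> Y)"
    using f_old f_new by (intro image_cong refl; blast)+
  have "inj_on f (A1 \<union> B1)" "inj_on f (X \<union> Y)"
    using inj1 \<phi>(1) inj_on_cong[of "A1 \<union> B1" f f1] inj_on_cong[of "X \<union> Y" f \<phi>] f_old f_new by auto
  moreover have "f ` (A1 \<union> B1) \<inter> f ` (X \<union> Y) = {}"
    unfolding img by (rule Int_emptyI) (metis imageE \<phi>(3))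
  ultimately have "inj_on f (A \<union> B)" unfolding AB by (rule inj_on_Un_disjoint)
  moreover have "f ` (A \<union> B) \<subseteq> fst G"
  proof -
    have "f ` (A1 \<union> B1) \<subseteq> fst G"
      unfolding img(1) unfolding image_Un
      using subset_trans[OF imgA subset_trans[OF S(1) common_nbrs_subset]]
        subset_trans[OF imgB subset_trans[OF T(1) common_nbrs_subset]] by (rule Un_least)
    moreover have "f ` (X \<union> Y) \<subseteq> fst G"
    proof (rule image_subsetI)
      fix z assume "z \<in> X \<union> Y"
      then show "f z \<in> fst G"
        using \<phi>(2)[of z] f_new[of z] by (simp add: P_def common_nbrs_def)
    qed
    ultimately show ?thesis unfolding AB image_Un by (rule Un_least)
  qed
  moreover have "f ` e \<in> snd G" if "e \<in> E" for e
  proof -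
    from that consider "e \<in> E1" | x a where "x \<in> X" "a \<in> g x" "e = {x, a}"
      | y b where "y \<in> Y" "b \<in> h y" "e = {y, b}" unfolding step(3) by blast
    then show ?thesis
    proof cases
      case 1
      then have "f ` e = f1 ` e" using f_old E1 by (intro image_cong refl) blast
      then show ?thesis using E1_edge 1 by simp
    next
      case 2
      then have "a \<in> A1" using step(10) by (auto simp: nsets_def)
      moreover have "\<phi> x \<in> ?N (f1 ` g x)" using \<phi>(2)[of x] 2 by (auto simp: P_def)
      ultimately show ?thesis using 2 f_old f_new
        by (auto simp: common_nbrs_def insert_commute)
    next
      case 3
      then have "b \<in> B1" using step(12) by (auto simp: nsets_def)
      moreover have "y \<notin> X" using 3 step(9) by auto
      then have "\<phi> y \<in> ?N (f1 ` h y)" using \<phi>(2)[of y] 3 by (auto simp: P_def)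
      ultimately show ?thesis using 3 f_old f_new
        by (auto simp: common_nbrs_def insert_commute)
    qed
  qed
  ultimately show ?thesis by (auto simp: contains_subgraph_def)
qed

section \<open>From the embedding to the extremal number\<close>

lemma complete_degenerate_bipartite_edges_nonempty:
  assumes "complete_degenerate_bipartite r m s A B E" "r \<ge> 1"
  shows "E \<noteq> {}"
  using assms
proof (induction rule: complete_degenerate_bipartite.induct)
  case (base A B)
  then have "A \<noteq> {}" "B \<noteq> {}" by auto
  then show ?case by blast
qed blast

theorem theorem1p5:
  fixes r m :: nat and A B :: "'a set" and E :: "'a set set"
  assumes "r \<ge> 1" and "m \<ge> 1"
    and "complete_degenerate_bipartite r m 2 A B E"
  shows "\<exists>C::real. \<forall>n::nat. real (ex_num n (A \<union> B, E)) \<le> C * real n powr (2 - 1 / real r)"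
proof -
  define k where "k = r + 2 * m"
  define M where "M = card (A \<union> B)"
  \<comment> \<open>\<open>K\<close> is the factor in \<open>ex_extendable_pair\<close>, and
    \<open>C\<close> the constant of \<open>many_bicliques\<close> for \<open>L = K + 1\<close>; the
    extra 1 makes the inequality strict.\<close>
  define K where "K = 2 * (k choose r) * ((M choose r) + 1)"
  define C where "C = real r ^ r * (real (K + 1) + real r + 1)"
  have F: "complete_degenerate_bipartite r m (Suc (Suc 0)) A B E"
    using assms(3) by (simp add: numeral_2_eq_2)
  have bound: "real (card (snd G)) \<le> C * real n powr (2 - 1 / real r)"
    if G: "simple_graph G" "card (fst G) = n" "\<not> contains_subgraph G (A \<union> B, E)"
    for n and G :: "nat graph"
  proof (cases "n = 0")
    \<comment> \<open>Both sides are 0, since \<open>0 powr x = 0\<close>.\<close>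
    case True
    then have "snd G = {}" using G by (auto simp: simple_graph_def nsets_def)
    then show ?thesis using True by simp
  next
    case False
    show ?thesis
    proof (rule ccontr)
      assume "\<not> ?thesis"
      then have "real (K + 1) * real n ^ r \<le> real (card (biclique_pairs G r r))"
        using many_bicliques[OF G(1,2) _ assms(1), of "real (K + 1)"] False by (simp add: C_def)
      then have "(K + 1) * n ^ r \<le> card (biclique_pairs G r r)"
        by (metis of_nat_le_iff of_nat_mult of_nat_power)
      moreover have "K * (n choose r) \<le> K * n ^ r"
        by (intro mult_left_mono binomial_le_power) simp
      moreover have "n ^ r > 0" using False by simp
      ultimately have "K * (n choose r) < card (biclique_pairs G r r)"
        unfolding add_mult_distrib mult_1 by linarith
      then obtain S T where "(S, T) \<in> biclique_pairs G r r"
        "extendable G r M k S T" "extendable G r M k T S"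
        using ex_extendable_pair[OF G(1), of r k M] unfolding K_def G(2) k_def by auto
      then show False
        using embed_complexity_two[OF G(1) F k_def M_def] G(3) by blast
    qed
  qed
  have "real (ex_num n (A \<union> B, E)) \<le> C * real n powr (2 - 1 / real r)" for n
  proof -
    \<comment> \<open>An edge of \<open>F\<close> makes the edgeless host admissible, so the maximum
      in \<open>ex_num\<close> is attained by some host, to which \<open>bound\<close>
      applies.\<close>
    have "E \<noteq> {}" using complete_degenerate_bipartite_edges_nonempty assms by blast
    then have "ex_num n (A \<union> B, E) \<in> {card (snd G) | G :: nat graph.
        simple_graph G \<and> card (fst G) = n \<and> \<not> contains_subgraph G (A \<union> B, E)}"
      unfolding ex_num_def by (intro Max_in finite_ex_num_set ex_num_set_nonempty) simp
    then show ?thesis using bound by auto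
  qed
  then show ?thesis by blast
qed

end
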